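(* Let $X$ be a metrizable, separable, locally compact space and let $\mathcal F=\{f_1,\dots,f_m\}$ be an iterated function system on $X$ with compact dynamics and global attractor $\mathcal G_{\mathcal F}$. Then the chain graph of the Hutchinson map $H_{\mathcal F}$ has at least as many nodes (in the sense of cardinality) as the orbitwise chain graph of $\mathcal F$. In particular, if $H_{\mathcal F}$ has a unique chain node, then both the chain graph and the orbitwise chain graph of $\mathcal F$ have a unique node, and this node is $\mathcal G_{\mathcal F}$.
   Context: Fix a metric $d$ on $X$ compatible with its topology. An iterated function system (IFS) on a metric space $(Y,d)$ is a finite collection $\mathcal F=\{f_1,\dots,f_m\}$, $m\ge1$, of continuous maps $Y\to Y$. $\mathcal I^m$ is the set of all finite words in the letters $1,\dots,m$ (including the empty word $0$); $|I|$ is the length of $I$. For $I=i_1\cdots i_k$, $\Phi^I_{\mathcal F}=f_{i_k}\circ\dots\circ f_{i_1}$, and $\Phi^0_{\mathcal F}=\mathrm{id}$. For $A\subset Y$, $H_{\mathcal F}(A)=\bigcup_{i=1}^m f_i(A)$; $A$ is $H$-invariant if $H_{\mathcal F}(A)=A$. The orbit of $x$ is $\mathcal O_{\mathcal F}(x)=\{\Phi^I_{\mathcal F}(x): I\in\mathcal I^m\}$. $N_\varepsilon(A)=\{x:d(x,A)<\varepsilon\}$. $A$ attracts $K$ if for every $\varepsilon>0$ there is $\tau>0$ with $\Phi^I_{\mathcal F}(K)\subset N_\varepsilon(A)$ for every $|I|\ge\tau$. A global attractor is a compact $H$-invariant set that attracts every compact subset of the space; it is unique if it exists and is denoted $\mathcal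 G_{\mathcal F}$. $\mathcal F$ has compact dynamics if it has a global attractor. Chains: an $\varepsilon$-chain from $x$ to $y$ is a finite sequence $x_0=x,x_1,\dots,x_k=y$ ($k\ge0$) with indices $i_0,\dots,i_{k-1}$ such that $d(f_{i_n}(x_n),x_{n+1})<\varepsilon$ for $n=0,\dots,k-1$. Write $x\succcurlyeq y$ if for every $\varepsilon>0$ there is an $\varepsilon$-chain from $x$ to $y$; $x,y$ are chain-equivalent if $x\succcurlyeq y$ and $y\succcurlyeq x$. A point $x$ is chain-recurrent if it is chain-equivalent to $f_i(x)$ for some $i$; it is orbitwise chain-recurrent if it is chain-equivalent to every point of $\mathcal O_{\mathcal F}(x)$. Chain nodes (resp. orbitwise chain nodes) are the chain-equivalence classes of the set of chain-recurrent (resp. orbitwise chain-recurrent) points. The chain graph (resp. orbitwise chain graph) has these as vertices, with an edge from $N_1$ to $N_2\ne N_1$ when $x\succcurlyeq y$ for some $x\in N_1,y\in N_2$. $\mathcal K(X)$ is the space of all non-empty compact subsets of $X$ with the Hausdorff metric $d_H(A,B)=\max\{\sup_{a\in A}d(a,B),\sup_{b\in B}d(b,A)\}$. The Hutchinson map is $H_{\mathcal F}:\mathcal K(X)\to\mathcal K(X)$, $H_{\mathcal F}(K)=\bigcup_{i=1}^m f_i(K)$. Its chain nodes and chain graph are those of the one-generator IFS $\{H_{\mathcal F}\}$ on $(\mathcal K(X),d_H)$. *)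

theory Defs
  imports
    "HOL-Analysis.Analysis"
    "HOL-Library.Equipollence"
    "Graph_Theory.Pair_Digraph"
begin

section \<open>Iterated function systems on a metric space\<close>

definition ifs :: "nat \<Rightarrow> (nat \<Rightarrow> 'a::topological_space \<Rightarrow> 'a) \<Rightarrow> bool"
  where "ifs m f \<longleftrightarrow> m \<ge> 1 \<and> (\<forall>i\<in>{1..m}. continuous_on UNIV (f i))"

definition words :: "nat \<Rightarrow> nat list set"
  where "words m = lists {1..m}"

text \<open>The first letter of the word acts first: for \<open>I = [i\<^sub>1, \<dots>, i\<^sub>k]\<close> the map
  \<open>word_map f I\<close> is \<open>f i\<^sub>k \<circ> \<dots> \<circ> f i\<^sub>1\<close>, and the empty word gives the identity.\<close>

definition word_map :: "(nat \<Rightarrow> 'a \<Rightarrow> 'a) \<Rightarrow> nat list \<Rightarrow> 'a \<Rightarrow> 'a"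
  where "word_map f I = fold f I"

definition ifs_orbit :: "nat \<Rightarrow> (nat \<Rightarrow> 'a \<Rightarrow> 'a) \<Rightarrow> 'a \<Rightarrow> 'a set"
  where "ifs_orbit m f x = {word_map f I x | I. I \<in> words m}"

definition hutchinson :: "nat \<Rightarrow> (nat \<Rightarrow> 'a \<Rightarrow> 'a) \<Rightarrow> 'a set \<Rightarrow> 'a set"
  where "hutchinson m f A = (\<Union>i\<in>{1..m}. f i ` A)"

text \<open>The guard \<open>A \<noteq> {}\<close> is needed because the library sets \<open>infdist x {} = 0\<close>; the
  neighbourhood of the empty set has to be empty.\<close>

definition nbhd :: "real \<Rightarrow> 'a::metric_space set \<Rightarrow> 'a set"
  where "nbhd \<epsilon> A = {x. A \<noteq> {} \<and> infdist x A < \<epsilon>}"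

definition attracts :: "nat \<Rightarrow> (nat \<Rightarrow> 'a::metric_space \<Rightarrow> 'a) \<Rightarrow> 'a set \<Rightarrow> 'a set \<Rightarrow> bool"
  where "attracts m f A K \<longleftrightarrow>
    (\<forall>\<epsilon>>0. \<exists>\<tau>>0. \<forall>I\<in>words m. \<tau> \<le> length I \<longrightarrow> word_map f I ` K \<subseteq> nbhd \<epsilon> A)"

definition global_attractor :: "nat \<Rightarrow> (nat \<Rightarrow> 'a::metric_space \<Rightarrow> 'a) \<Rightarrow> 'a set \<Rightarrow> bool"
  where "global_attractor m f G \<longleftrightarrow>
    compact G \<and> hutchinson m f G = G \<and> (\<forall>K. compact K \<longrightarrow> attracts m f G K)"

section \<open>Chains, chain-recurrence and chain graphs\<close>

text \<open>These notions take the carrier \<open>Y\<close> and the metric \<open>d\<close> of the phase space as explicit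
  parameters, because they are used both for the space itself and for its hyperspace of
  non-empty compact subsets.\<close>

definition eps_chain ::
    "'b set \<Rightarrow> ('b \<Rightarrow> 'b \<Rightarrow> real) \<Rightarrow> nat \<Rightarrow> (nat \<Rightarrow> 'b \<Rightarrow> 'b) \<Rightarrow> real \<Rightarrow> 'b \<Rightarrow> 'b \<Rightarrow> bool"
  where "eps_chain Y d m f \<epsilon> x y \<longleftrightarrow>
    (\<exists>(k::nat) (s::nat \<Rightarrow> 'b) (i::nat \<Rightarrow> nat).
       s 0 = x \<and> s k = y \<and> (\<forall>n\<le>k. s n \<in> Y) \<and>
       (\<forall>n<k. i n \<in> {1..m} \<and> d (f (i n) (s n)) (s (Suc n)) < \<epsilon>))"

definition chain_geq ::
    "'b set \<Rightarrow> ('b \<Rightarrow> 'b \<Rightarrow> real) \<Rightarrow> nat \<Rightarrow> (nat \<Rightarrow> 'b \<Rightarrow> 'b) \<Rightarrow> 'b \<Rightarrow> 'b \<Rightarrow> bool"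
  where "chain_geq Y d m f x y \<longleftrightarrow> (\<forall>\<epsilon>>0. eps_chain Y d m f \<epsilon> x y)"

definition chain_equiv ::
    "'b set \<Rightarrow> ('b \<Rightarrow> 'b \<Rightarrow> real) \<Rightarrow> nat \<Rightarrow> (nat \<Rightarrow> 'b \<Rightarrow> 'b) \<Rightarrow> 'b \<Rightarrow> 'b \<Rightarrow> bool"
  where "chain_equiv Y d m f x y \<longleftrightarrow> chain_geq Y d m f x y \<and> chain_geq Y d m f y x"

definition chain_recurrent ::
    "'b set \<Rightarrow> ('b \<Rightarrow> 'b \<Rightarrow> real) \<Rightarrow> nat \<Rightarrow> (nat \<Rightarrow> 'b \<Rightarrow> 'b) \<Rightarrow> 'b set"
  where "chain_recurrent Y d m f = {x \<in> Y. \<exists>i\<in>{1..m}. chain_equiv Y d m f x (f i x)}"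

definition orbitwise_chain_recurrent ::
    "'b set \<Rightarrow> ('b \<Rightarrow> 'b \<Rightarrow> real) \<Rightarrow> nat \<Rightarrow> (nat \<Rightarrow> 'b \<Rightarrow> 'b) \<Rightarrow> 'b set"
  where "orbitwise_chain_recurrent Y d m f =
    {x \<in> Y. \<forall>y\<in>ifs_orbit m f x. chain_equiv Y d m f x y}"

definition chain_classes ::
    "'b set \<Rightarrow> ('b \<Rightarrow> 'b \<Rightarrow> real) \<Rightarrow> nat \<Rightarrow> (nat \<Rightarrow> 'b \<Rightarrow> 'b) \<Rightarrow> 'b set \<Rightarrow> 'b set set"
  where "chain_classes Y d m f R = R // {(x, y). x \<in> R \<and> y \<in> R \<and> chain_equiv Y d m f x y}"

definition graph_of_nodes ::
    "'b set \<Rightarrow> ('b \<Rightarrow> 'b \<Rightarrow> real) \<Rightarrow> nat \<Rightarrow> (nat \<Rightarrow> 'b \<Rightarrow> 'b) \<Rightarrow> 'b set set \<Rightarrow> 'b set pair_pre_digraph"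
  where "graph_of_nodes Y d m f V =
    \<lparr> pverts = V,
      parcs = {(N1, N2). N1 \<in> V \<and> N2 \<in> V \<and> N2 \<noteq> N1 \<and>
                 (\<exists>x\<in>N1. \<exists>y\<in>N2. chain_geq Y d m f x y)} \<rparr>"

definition chain_graph ::
    "'b set \<Rightarrow> ('b \<Rightarrow> 'b \<Rightarrow> real) \<Rightarrow> nat \<Rightarrow> (nat \<Rightarrow> 'b \<Rightarrow> 'b) \<Rightarrow> 'b set pair_pre_digraph"
  where "chain_graph Y d m f =
    graph_of_nodes Y d m f (chain_classes Y d m f (chain_recurrent Y d m f))"

definition orbitwise_chain_graph ::
    "'b set \<Rightarrow> ('b \<Rightarrow> 'b \<Rightarrow> real) \<Rightarrow> nat \<Rightarrow> (nat \<Rightarrow> 'b \<Rightarrow> 'b) \<Rightarrow> 'b set pair_pre_digraph"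
  where "orbitwise_chain_graph Y d m f =
    graph_of_nodes Y d m f (chain_classes Y d m f (orbitwise_chain_recurrent Y d m f))"

section \<open>The hyperspace of compact sets and the Hutchinson map\<close>

definition hyperspace :: "'a::topological_space set set"
  where "hyperspace = {K. compact K \<and> K \<noteq> {}}"

text \<open>Only meant for non-empty bounded sets, where the suprema of reals exist.\<close>

definition hausdorff_dist :: "'a::metric_space set \<Rightarrow> 'a set \<Rightarrow> real"
  where "hausdorff_dist A B = max (SUP a\<in>A. infdist a B) (SUP b\<in>B. infdist b A)"

definition hutchinson_chain_graph ::
    "nat \<Rightarrow> (nat \<Rightarrow> 'a::metric_space \<Rightarrow> 'a) \<Rightarrow> 'a set set pair_pre_digraph"
  where "hutchinson_chain_graph m f =
    chain_graph hyperspace hausdorff_dist 1 (\<lambda>_. hutchinson m f)"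

end

theory Submission
  imports Defs
begin

text \<open>A chain of the Hutchinson map from \<open>A\<close> to \<open>B\<close> can be read backwards from any point \<open>b\<close> of
  \<open>B\<close>, which gives a chain of \<open>f\<close> from some point of \<open>A\<close> to \<open>b\<close>. So it is enough to attach to an
  orbitwise chain-recurrent point \<open>x\<close> a compact set \<open>A\<close> that is chain-recurrent for the Hutchinson
  map and consists of points chain-equivalent to \<open>x\<close>. The closure of the orbit of \<open>x\<close> is compact,
  because chain-recurrent points lie in the attractor, and is mapped into itself; the intersection
  of its iterated images is a fixed point \<open>A\<close> of the Hutchinson map. If that map has only one
  chain node, then for every \<open>x\<close> in the attractor \<open>G\<close> the fixed point obtained from the orbit of
  \<open>x\<close> is equivalent to \<open>G\<close>, so every point of \<open>G\<close> is reached by chains from \<open>x\<close>.\<close>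

section \<open>Chains as powers of a relation\<close>

text \<open>Both endpoints lie in \<open>Y\<close>, so the powers of the relation stay in the phase
  space; in the hyperspace this keeps every set met compact and non-empty.\<close>

definition chain_step ::
    "'b set \<Rightarrow> ('b \<Rightarrow> 'b \<Rightarrow> real) \<Rightarrow> nat \<Rightarrow> (nat \<Rightarrow> 'b \<Rightarrow> 'b) \<Rightarrow> real \<Rightarrow> ('b \<times> 'b) set"
  where "chain_step Y d m f \<epsilon> =
    {(x, y). x \<in> Y \<and> y \<in> Y \<and> (\<exists>i\<in>{1..m}. d (f i x) y < \<epsilon>)}"

text \<open>The reflexive closure relates every point to itself, also outside \<open>Y\<close>; the
  conjunct \<open>x \<in> Y\<close> covers chains of length 0.\<close>

lemma eps_chain_iff:
  "eps_chain Y d m f \<epsilon> x y \<longleftrightarrow> x \<in> Y \<and> (x, y) \<in> (chain_step Y d m f \<epsilon>)\<^sup>*"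
proof
  assume "eps_chain Y d m f \<epsilon> x y"
  then obtain k s i where s: "s 0 = x" "s k = y" "\<forall>n\<le>k. s n \<in> Y"
      "\<forall>n<k. i n \<in> {1..m} \<and> d (f (i n) (s n)) (s (Suc n)) < \<epsilon>"
    unfolding eps_chain_def by blast
  then have "\<forall>n<k. (s n, s (Suc n)) \<in> chain_step Y d m f \<epsilon>"
    unfolding chain_step_def by force
  with s(1,2) have "(x, y) \<in> chain_step Y d m f \<epsilon> ^^ k"
    unfolding relpow_fun_conv by blast
  with s show "x \<in> Y \<and> (x, y) \<in> (chain_step Y d m f \<epsilon>)\<^sup>*"
    by (auto intro: relpow_imp_rtrancl)
next
  assume *: "x \<in> Y \<and> (x, y) \<in> (chain_step Y d m f \<epsilon>)\<^sup>*"
  then obtain k where "(x, y) \<in> chain_step Y d m f \<epsilon> ^^ k"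
    by (blast dest: rtrancl_imp_relpow)
  then obtain s where s: "s 0 = x" "s k = y"
      "\<forall>n<k. (s n, s (Suc n)) \<in> chain_step Y d m f \<epsilon>"
    unfolding relpow_fun_conv by blast
  then have "\<forall>n. \<exists>i. n < k \<longrightarrow> i \<in> {1..m} \<and> d (f i (s n)) (s (Suc n)) < \<epsilon>"
    unfolding chain_step_def by blast
  then obtain i where "\<forall>n<k. i n \<in> {1..m} \<and> d (f (i n) (s n)) (s (Suc n)) < \<epsilon>"
    by metis
  moreover have "s n \<in> Y" if "n \<le> k" for n
    using that s * by (cases n) (auto simp: chain_step_def Suc_le_eq)
  ultimately show "eps_chain Y d m f \<epsilon> x y"
    unfolding eps_chain_def using s(1,2)
    by (intro exI[of _ k] exI[of _ s] exI[of _ i]) simp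
qed

lemma chain_step_mono: "\<epsilon> \<le> \<delta> \<Longrightarrow> chain_step Y d m f \<epsilon> \<subseteq> chain_step Y d m f \<delta>"
  unfolding chain_step_def by (auto intro: less_le_trans)

lemma chain_step_image:
  fixes f :: "nat \<Rightarrow> 'a::metric_space \<Rightarrow> 'a"
  assumes "i \<in> {1..m}" and "\<epsilon> > 0"
  shows "(x, f i x) \<in> chain_step UNIV dist m f \<epsilon>"
  unfolding chain_step_def using assms by (auto intro!: bexI[of _ i])

lemma chain_geq_iff:
  "chain_geq Y d m f x y \<longleftrightarrow> x \<in> Y \<and> (\<forall>\<epsilon>>0. (x, y) \<in> (chain_step Y d m f \<epsilon>)\<^sup>*)"
  unfolding chain_geq_def eps_chain_iff by (metis zero_less_one)

lemma chain_geq_refl: "x \<in> Y \<Longrightarrow> chain_geq Y d m f x x"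
  by (simp add: chain_geq_iff)

lemma chain_geq_trans:
  "chain_geq Y d m f x y \<Longrightarrow> chain_geq Y d m f y z \<Longrightarrow> chain_geq Y d m f x z"
  unfolding chain_geq_iff by (meson rtrancl_trans)

lemma chain_equiv_refl: "x \<in> Y \<Longrightarrow> chain_equiv Y d m f x x"
  by (simp add: chain_equiv_def chain_geq_refl)

lemma chain_equiv_sym: "chain_equiv Y d m f x y \<Longrightarrow> chain_equiv Y d m f y x"
  by (simp add: chain_equiv_def)

lemma chain_equiv_trans:
  "chain_equiv Y d m f x y \<Longrightarrow> chain_equiv Y d m f y z \<Longrightarrow> chain_equiv Y d m f x z"
  unfolding chain_equiv_def by (meson chain_geq_trans)

lemma equiv_chain_equiv:
  "R \<subseteq> Y \<Longrightarrow> equiv R {(x, y). x \<in> R \<and> y \<in> R \<and> chain_equiv Y d m f x y}"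
  by (intro equivI refl_onI symI transI)
    (auto intro: chain_equiv_refl chain_equiv_sym chain_equiv_trans)

lemma chain_recurrent_subset: "chain_recurrent Y d m f \<subseteq> Y"
  by (auto simp: chain_recurrent_def)

section \<open>Orbits and the chains along them\<close>

lemma word_map_in_ifs_orbit: "I \<in> words m \<Longrightarrow> word_map f I x \<in> ifs_orbit m f x"
  by (auto simp: ifs_orbit_def)

lemma ifs_orbit_refl: "x \<in> ifs_orbit m f x"
  using word_map_in_ifs_orbit[of "[]" m f x] by (simp add: words_def word_map_def)

lemma ifs_orbit_step:
  assumes "y \<in> ifs_orbit m f x" and i: "i \<in> {1..m}"
  shows "f i y \<in> ifs_orbit m f x"
proof -
  obtain I where I: "I \<in> words m" "y = word_map f I x"
    using assms(1) by (auto simp: ifs_orbit_def)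
  then have "I @ [i] \<in> words m" "f i y = word_map f (I @ [i]) x"
    using i by (auto simp: words_def word_map_def)
  then show ?thesis
    using word_map_in_ifs_orbit by metis
qed

text \<open>The last letter of a word acts last, so induction from the right end adds one
  application of a single map.\<close>

lemma ifs_orbit_subset:
  assumes "hutchinson m f A \<subseteq> A" and "x \<in> A"
  shows "ifs_orbit m f x \<subseteq> A"
proof -
  have "set I \<subseteq> {1..m} \<Longrightarrow> word_map f I x \<in> A" for I
  proof (induction I rule: rev_induct)
    case Nil
    then show ?case using assms(2) by (simp add: word_map_def)
  next
    case (snoc i I)
    then have "f i (word_map f I x) \<in> hutchinson m f A" by (auto simp: hutchinson_def)
    then have "f i (word_map f I x) \<in> A" using assms(1) by blast
    then show ?case by (simp add: word_map_def)
  qed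
  then show ?thesis by (auto simp: ifs_orbit_def words_def)
qed

text \<open>Following a word exactly gives a chain with error 0 at each step.\<close>

lemma chain_geq_ifs_orbit:
  fixes f :: "nat \<Rightarrow> 'a::metric_space \<Rightarrow> 'a"
  assumes "y \<in> ifs_orbit m f x"
  shows "chain_geq UNIV dist m f x y"
proof -
  have "set I \<subseteq> {1..m} \<Longrightarrow> chain_geq UNIV dist m f x (word_map f I x)" for I
  proof (induction I rule: rev_induct)
    case Nil
    then show ?case by (simp add: word_map_def chain_geq_refl)
  next
    case (snoc i I)
    have "(word_map f I x, word_map f (I @ [i]) x) \<in> chain_step UNIV dist m f \<epsilon>" if "\<epsilon> > 0" for \<epsilon>
      using snoc.prems that chain_step_image[of i m \<epsilon> "word_map f I x" f]
      by (simp add: word_map_def)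
    then have "chain_geq UNIV dist m f (word_map f I x) (word_map f (I @ [i]) x)"
      by (auto simp: chain_geq_iff)
    with snoc show ?case using chain_geq_trans by fastforce
  qed
  with assms show ?thesis by (auto simp: ifs_orbit_def words_def)
qed

lemma orbitwise_chain_recurrent_subset_chain_recurrent:
  assumes "m \<ge> 1"
  shows "orbitwise_chain_recurrent Y d m f \<subseteq> chain_recurrent Y d m f"
proof
  fix x assume x: "x \<in> orbitwise_chain_recurrent Y d m f"
  have "f 1 x \<in> ifs_orbit m f x"
    using assms by (intro ifs_orbit_step ifs_orbit_refl) simp
  with x have "x \<in> Y" "chain_equiv Y d m f x (f 1 x)"
    by (simp_all add: orbitwise_chain_recurrent_def)
  then show "x \<in> chain_recurrent Y d m f"
    using assms by (auto simp: chain_recurrent_def)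
qed

section \<open>Chain-recurrent points lie in the attractor\<close>

lemma infdist_less_obtains:
  assumes "A \<noteq> {}" and "infdist x A < \<epsilon>"
  obtains a where "a \<in> A" and "dist x a < \<epsilon>"
  using assms by (auto simp: infdist_notempty cINF_less_iff)

text \<open>Only \<open>a\<close> is confined to \<open>K\<close>, while \<open>z\<close> ranges
  over the whole space. The value \<open>\<delta>\<close> is a Lebesgue number of the cover of
  \<open>K\<close> by preimages of balls of radius \<open>\<eta> / 2\<close>.\<close>

lemma continuous_uniformly_near_compact:
  fixes f :: "'a::metric_space \<Rightarrow> 'b::metric_space"
  assumes f: "continuous_on UNIV f" and K: "compact K" and "\<eta> > 0"
  obtains \<delta> where "\<delta> > 0" "\<And>a z. a \<in> K \<Longrightarrow> dist a z < \<delta> \<Longrightarrow> dist (f a) (f z) < \<eta>"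
proof -
  define B where "B a = f -` ball (f a) (\<eta> / 2)" for a
  have op: "open U" if "U \<in> B ` K" for U
    using that f by (auto simp: B_def open_vimage)
  have cover: "K \<subseteq> \<Union>(B ` K)"
    using \<open>\<eta> > 0\<close> by (auto simp: B_def)
  obtain \<delta> where \<delta>: "\<delta> > 0" "\<And>x. x \<in> K \<Longrightarrow> \<exists>U\<in>B ` K. ball x \<delta> \<subseteq> U"
    using Heine_Borel_lemma[OF K cover op] by metis
  have "dist (f a) (f z) < \<eta>" if az: "a \<in> K" "dist a z < \<delta>" for a z
  proof -
    obtain b where b: "ball a \<delta> \<subseteq> B b"
      using \<delta>(2)[OF az(1)] by blast
    have "a \<in> B b" "z \<in> B b"
      using az(2) \<open>\<delta> > 0\<close> by (simp_all add: subsetD[OF b])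
    then show ?thesis
      by (auto simp: B_def intro: dist_triangle_half_r)
  qed
  with \<delta>(1) show thesis by (rule that)
qed

section \<open>Shadowing of chains of fixed length\<close>

lemma ifs_continuous_on: "ifs m f \<Longrightarrow> i \<in> {1..m} \<Longrightarrow> continuous_on S (f i)"
  by (metis continuous_on_subset ifs_def subset_UNIV)

lemma continuous_word_map:
  assumes "ifs m f" and "set I \<subseteq> {1..m}"
  shows "continuous_on S (word_map f I)"
  using assms(2)
proof (induction I rule: rev_induct)
  case Nil
  then show ?case by (simp add: word_map_def)
next
  case (snoc i I)
  have "continuous_on S (f i \<circ> word_map f I)"
    using snoc ifs_continuous_on[OF assms(1)] by (intro continuous_on_compose) simp_all
  then show ?case by (simp add: word_map_def comp_def)
qed

lemma relpow_mono:
  fixes R S :: "('a \<times> 'a) set"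
  shows "R \<subseteq> S \<Longrightarrow> R ^^ n \<subseteq> S ^^ n"
  by (induction n) auto

text \<open>Induction on the length: half of \<open>\<eta>\<close> absorbs the error of the last
  step, the other half the earlier deviation after one more map, by continuity near a compact
  set.\<close>

lemma shadowing:
  fixes f :: "nat \<Rightarrow> 'a::metric_space \<Rightarrow> 'a"
  assumes F: "ifs m f" and K: "compact K" and "\<eta> > 0"
  shows "\<exists>\<epsilon>>0. \<forall>x\<in>K. \<forall>y. (x, y) \<in> chain_step UNIV dist m f \<epsilon> ^^ n \<longrightarrow>
    (\<exists>I\<in>words m. length I = n \<and> dist (word_map f I x) y < \<eta>)"
  using \<open>\<eta> > 0\<close>
proof (induction n arbitrary: \<eta>)
  case 0
  then show ?case
    by (intro exI[of _ 1]) (auto simp: words_def word_map_def intro!: bexI[of _ "[]"])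
next
  case (Suc n)
  let ?W = "{I. set I \<subseteq> {1..m} \<and> length I = n}"
  \<comment> \<open>A finite union of compact images, holding all exact positions after
    \<open>n\<close> steps. The chain itself may leave \<open>L\<close>, hence continuity is needed
    near \<open>L\<close> and not merely on it.\<close>
  define L where "L = (\<Union>I\<in>?W. word_map f I ` K)"
  have L: "compact L"
    unfolding L_def
    using K continuous_word_map[OF F]
    by (intro compact_UN finite_lists_length_eq compact_continuous_image) simp_all
  have "\<exists>\<delta>>0. \<forall>a\<in>L. \<forall>z. dist a z < \<delta> \<longrightarrow> dist (f i a) (f i z) < \<eta> / 2" if "i \<in> {1..m}" for i
    by (rule continuous_uniformly_near_compact[OF ifs_continuous_on[OF F that] L half_gt_zero[OF Suc.prems]])
      blast
  then obtain \<delta> where \<delta>: "\<And>i. i \<in> {1..m} \<Longrightarrow> \<delta> i > 0"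
      "\<And>i a z. i \<in> {1..m} \<Longrightarrow> a \<in> L \<Longrightarrow> dist a z < \<delta> i \<Longrightarrow> dist (f i a) (f i z) < \<eta> / 2"
    by metis
  define \<delta>' where "\<delta>' = Min (\<delta> ` {1..m})"
  have ne: "{1..m} \<noteq> {}" using F by (simp add: ifs_def)
  then have \<delta>': "\<delta>' > 0" "\<And>i. i \<in> {1..m} \<Longrightarrow> \<delta>' \<le> \<delta> i"
    using \<delta>(1) by (auto simp: \<delta>'_def)
  obtain \<epsilon> where \<epsilon>: "\<epsilon> > 0" "\<And>x y. x \<in> K \<Longrightarrow> (x, y) \<in> chain_step UNIV dist m f \<epsilon> ^^ n \<Longrightarrow>
      \<exists>I\<in>words m. length I = n \<and> dist (word_map f I x) y < \<delta>'"
    using Suc.IH[OF \<delta>'(1)] by blast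
  \<comment> \<open>The bound \<open>\<epsilon>\<close> serves the first \<open>n\<close> steps,
    \<open>\<eta> / 2\<close> the last one.\<close>
  define \<epsilon>' where "\<epsilon>' = min \<epsilon> (\<eta> / 2)"
  show ?case
  proof (intro exI[of _ \<epsilon>'] conjI ballI allI impI)
    show "\<epsilon>' > 0" using \<epsilon>(1) Suc.prems by (simp add: \<epsilon>'_def)
    fix x y assume x: "x \<in> K" and "(x, y) \<in> chain_step UNIV dist m f \<epsilon>' ^^ Suc n"
    then obtain z where z: "(x, z) \<in> chain_step UNIV dist m f \<epsilon>' ^^ n"
        "(z, y) \<in> chain_step UNIV dist m f \<epsilon>'"
      by (auto elim: relpow_Suc_E)
    have "chain_step UNIV dist m f \<epsilon>' \<subseteq> chain_step UNIV dist m f \<epsilon>"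
      by (rule chain_step_mono) (simp add: \<epsilon>'_def)
    then have "(x, z) \<in> chain_step UNIV dist m f \<epsilon> ^^ n"
      using z(1) relpow_mono by blast
    then obtain I where I: "I \<in> words m" "length I = n" "dist (word_map f I x) z < \<delta>'"
      using \<epsilon>(2) x by blast
    obtain i where i: "i \<in> {1..m}" "dist (f i z) y < \<eta> / 2"
      using z(2) by (auto simp: chain_step_def \<epsilon>'_def)
    have "word_map f I x \<in> L"
      using I x by (auto simp: words_def L_def)
    then have "dist (f i (word_map f I x)) (f i z) < \<eta> / 2"
      using \<delta>(2)[OF i(1)] I(3) \<delta>'(2)[OF i(1)] by force
    then have "dist (word_map f (I @ [i]) x) y < \<eta>"
      using i(2) dist_triangle_less_add[of "f i (word_map f I x)" "f i z" "\<eta> / 2" y "\<eta> / 2"]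
      by (simp add: word_map_def dist_commute)
    moreover have "I @ [i] \<in> words m" "length (I @ [i]) = Suc n"
      using I i by (auto simp: words_def)
    ultimately show "\<exists>I\<in>words m. length I = Suc n \<and> dist (word_map f I x) y < \<eta>"
      by blast
  qed
qed

text \<open>A chain of length \<open>T * Suc k\<close> from \<open>A\<close> returns to \<open>B\<close>, so a loop repeated \<open>T\<close> times puts its
  base point into any given neighbourhood of the attractor.\<close>

lemma relpow_return:
  assumes "\<And>x y. x \<in> A \<Longrightarrow> (x, y) \<in> R ^^ T \<Longrightarrow> y \<in> B" and "B \<subseteq> A"
    and "x \<in> A" "(x, y) \<in> R ^^ (T * Suc k)"
  shows "y \<in> B"
  using assms(3,4)
proof (induction k arbitrary: y)
  case 0
  then show ?case using assms(1) by simp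
next
  case (Suc k)
  have "R ^^ (T * Suc (Suc k)) = R ^^ (T * Suc k) O R ^^ T"
    by (metis mult_Suc_right add.commute relpow_add)
  then obtain z where "(x, z) \<in> R ^^ (T * Suc k)" "(z, y) \<in> R ^^ T"
    using Suc.prems(2) by auto
  then show ?case
    using Suc.IH Suc.prems(1) assms(1,2) by blast
qed

text \<open>Repetition turns a loop of unknown length into one whose length is a multiple of a
  prescribed number.\<close>

lemma relpow_loop: "(x, x) \<in> R ^^ l \<Longrightarrow> (x, x) \<in> R ^^ (l * n)"
proof (induction n)
  case (Suc n)
  then have "(x, x) \<in> R ^^ l O R ^^ (l * n)" by blast
  then show ?case by (simp add: relpow_add)
qed simp

text \<open>A single point is compact and hence attracted, whereas the neighbourhood of the empty
  set is empty.\<close>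

lemma global_attractor_nonempty:
  assumes "global_attractor m f G" and "m \<ge> 1"
  shows "G \<noteq> {}"
proof -
  have "attracts m f G {undefined}"
    using assms by (simp add: global_attractor_def)
  then obtain \<tau> where \<tau>: "\<forall>I\<in>words m. \<tau> \<le> length I \<longrightarrow> word_map f I ` {undefined} \<subseteq> nbhd 1 G"
    unfolding attracts_def using zero_less_one by meson
  have "replicate \<tau> 1 \<in> words m"
    using assms(2) by (auto simp: words_def)
  with \<tau> have "word_map f (replicate \<tau> 1) undefined \<in> nbhd 1 G"
    by force
  then show ?thesis by (auto simp: nbhd_def)
qed

text \<open>Local compactness places \<open>G\<close> in an open \<open>U\<close> inside a compact
  \<open>L\<close>. A Lebesgue number of the cover \<open>{U}\<close> bounds the radii for which the
  closed neighbourhood stays in \<open>U\<close>.\<close>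

lemma compact_closed_neighbourhood:
  fixes G :: "'a::metric_space set"
  assumes lc: "locally_compact_space (euclidean :: 'a topology)" and G: "compact G" "G \<noteq> {}"
  obtains \<delta> where "\<delta> > 0" "\<And>\<eta>. \<eta> < \<delta> \<Longrightarrow> compact {x. infdist x G \<le> \<eta>}"
proof -
  have "Hausdorff_space (euclidean :: 'a topology)"
    by simp
  then obtain U L where U: "open U" "compact L" "G \<subseteq> U" "U \<subseteq> L"
    using lc G(1) locally_compact_space_compact_closed_compact[of "euclidean :: 'a topology"]
    by (metis compactin_euclidean_iff open_openin)
  obtain \<delta> where \<delta>: "\<delta> > 0" "\<And>g. g \<in> G \<Longrightarrow> ball g \<delta> \<subseteq> U"
    using Heine_Borel_lemma[OF G(1), of "{U}"] U by auto
  have "compact {x. infdist x G \<le> \<eta>}" if "\<eta> < \<delta>" for \<eta>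
  proof -
    have "{x. infdist x G \<le> \<eta>} \<subseteq> U"
    proof
      fix x assume "x \<in> {x. infdist x G \<le> \<eta>}"
      with \<open>\<eta> < \<delta>\<close> have "infdist x G < \<delta>"
        by simp
      then obtain g where "g \<in> G" "dist x g < \<delta>"
        by (rule infdist_less_obtains[OF G(2)])
      then show "x \<in> U" using \<delta>(2)[of g] by (auto simp: dist_commute)
    qed
    moreover have "closed {x. infdist x G \<le> \<eta>}"
      by (intro closed_Collect_le continuous_intros)
    ultimately show ?thesis
      using U by (metis compact_Int_closed inf.absorb2 order_trans)
  qed
  with \<delta>(1) show thesis by (rule that)
qed

text \<open>A recurrent point lies on loops of arbitrarily small error. Attraction and shadowing
  over exactly \<open>\<tau>\<close> steps bring chains back near \<open>G\<close>, so a loop run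
  \<open>\<tau>\<close> times must end there.\<close>

lemma chain_recurrent_subset_attractor:
  fixes f :: "nat \<Rightarrow> 'a::metric_space \<Rightarrow> 'a"
  assumes lc: "locally_compact_space (euclidean :: 'a topology)"
    and F: "ifs m f" and G: "global_attractor m f G"
  shows "chain_recurrent UNIV dist m f \<subseteq> G"
proof
  fix x assume "x \<in> chain_recurrent UNIV dist m f"
  then obtain i where i: "i \<in> {1..m}" "chain_geq UNIV dist m f (f i x) x"
    by (auto simp: chain_recurrent_def chain_equiv_def)
  have ne: "G \<noteq> {}" and cG: "compact G"
    using G F global_attractor_nonempty by (auto simp: ifs_def global_attractor_def)
  obtain \<delta> where \<delta>: "\<delta> > 0" "\<And>\<eta>. \<eta> < \<delta> \<Longrightarrow> compact {x. infdist x G \<le> \<eta>}"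
    using compact_closed_neighbourhood[OF lc cG ne] by blast
  have "infdist x G \<le> \<eta>" if \<eta>: "0 < \<eta>" "\<eta> < \<delta>" for \<eta>
  proof -
    let ?B = "{x. infdist x G \<le> \<eta>}"
    \<comment> \<open>The point \<open>x\<close> may be far from \<open>G\<close>; adjoining it lets
      one \<open>\<tau>\<close> and one \<open>\<epsilon>\<close> serve both the start and all later
      returns.\<close>
    let ?A = "insert x ?B"
    have A: "compact ?A" using \<delta>(2)[OF \<eta>(2)] by (rule compact_insert)
    then have "attracts m f G ?A"
      using G by (simp add: global_attractor_def)
    then obtain \<tau> where \<tau>: "\<tau> > 0"
        "\<And>I. I \<in> words m \<Longrightarrow> \<tau> \<le> length I \<Longrightarrow> word_map f I ` ?A \<subseteq> nbhd (\<eta> / 2) G"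
      unfolding attracts_def using half_gt_zero[OF \<eta>(1)] by meson
    obtain \<epsilon> where \<epsilon>: "\<epsilon> > 0" "\<And>a y. a \<in> ?A \<Longrightarrow> (a, y) \<in> chain_step UNIV dist m f \<epsilon> ^^ \<tau> \<Longrightarrow>
        \<exists>I\<in>words m. length I = \<tau> \<and> dist (word_map f I a) y < \<eta> / 2"
      using shadowing[OF F A half_gt_zero[OF \<eta>(1)], of \<tau>] by blast
    have return: "y \<in> ?B" if a: "a \<in> ?A" "(a, y) \<in> chain_step UNIV dist m f \<epsilon> ^^ \<tau>" for a y
    proof -
      obtain I where I: "I \<in> words m" "length I = \<tau>" "dist (word_map f I a) y < \<eta> / 2"
        using \<epsilon>(2)[OF a] by blast
      then have "infdist (word_map f I a) G < \<eta> / 2"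
        using \<tau>(2)[of I] a(1) by (auto simp: nbhd_def)
      with I(3) have "infdist y G < \<eta>"
        using infdist_triangle[of y G "word_map f I a"] by (simp add: dist_commute)
      then show ?thesis by simp
    qed
    \<comment> \<open>This exact step gives the loop positive length, as the form
      \<open>Suc l\<close> requires.\<close>
    have "(x, f i x) \<in> chain_step UNIV dist m f \<epsilon>"
      by (rule chain_step_image[OF i(1) \<epsilon>(1)])
    moreover have "(f i x, x) \<in> (chain_step UNIV dist m f \<epsilon>)\<^sup>*"
      using i(2) \<epsilon>(1) by (simp add: chain_geq_iff)
    ultimately obtain l where "(x, x) \<in> chain_step UNIV dist m f \<epsilon> ^^ Suc l"
      by (meson rtrancl_power relpow_Suc_I2)
    then have "(x, x) \<in> chain_step UNIV dist m f \<epsilon> ^^ (\<tau> * Suc l)"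
      using relpow_loop by (metis mult.commute)
    then have "x \<in> ?B"
      by (rule relpow_return[where A = ?A, rotated 3]) (use return in blast)+
    then show ?thesis by simp
  qed
  note small = this
  have "infdist x G \<le> 0"
  proof (rule field_le_epsilon)
    fix e :: real assume "e > 0"
    then show "infdist x G \<le> 0 + e"
      using small[of "min e (\<delta> / 2)"] \<delta>(1) by force
  qed
  then show "x \<in> G"
    using in_closed_iff_infdist_zero[of G x] cG ne infdist_nonneg[of x G]
    by (simp add: compact_imp_closed)
qed

section \<open>Fixed points of the Hutchinson map\<close>

lemma hutchinson_mono: "A \<subseteq> B \<Longrightarrow> hutchinson m f A \<subseteq> hutchinson m f B"
  by (auto simp: hutchinson_def)

lemma hutchinson_in_hyperspace:
  assumes "ifs m f" and "K \<in> hyperspace"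
  shows "hutchinson m f K \<in> hyperspace"
  using assms unfolding hutchinson_def hyperspace_def ifs_def
  by (auto intro!: compact_UN compact_continuous_image intro: continuous_on_subset)

text \<open>Cantor's intersection theorem: finitely many members all contain the one of largest
  index. Inserting 0 into \<open>N\<close> also covers empty \<open>N\<close>.\<close>

lemma compact_decseq_Inter_nonempty:
  fixes D :: "nat \<Rightarrow> 'a::t2_space set"
  assumes "\<And>n. compact (D n)" and "\<And>n. D n \<noteq> {}" and "decseq D"
  shows "(\<Inter>n. D n) \<noteq> {}"
proof -
  have "D 0 \<inter> (\<Inter>n\<in>UNIV. D n) \<noteq> {}"
  proof (rule compact_imp_fip_image)
    fix N :: "nat set" assume "finite N"
    then have "D (Max (insert 0 N)) \<subseteq> D 0 \<inter> (\<Inter>n\<in>N. D n)"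
      using decseqD[OF assms(3)] by (simp add: INT_greatest)
    then show "D 0 \<inter> (\<Inter>n\<in>N. D n) \<noteq> {}"
      using assms(2) by blast
  qed (use assms(1) in \<open>auto intro: compact_imp_closed\<close>)
  then show ?thesis by blast
qed

text \<open>The intersection of the iterated images is mapped into itself by monotonicity; that it
  is covered by its own image comes from compactness.\<close>

lemma hutchinson_fixed_point_below:
  fixes f :: "nat \<Rightarrow> 'a::metric_space \<Rightarrow> 'a"
  assumes F: "ifs m f" and C: "C \<in> hyperspace" "hutchinson m f C \<subseteq> C"
  obtains A where "A \<in> hyperspace" "A \<subseteq> C" "hutchinson m f A = A"
proof -
  define D where "D n = (hutchinson m f ^^ n) C" for n
  have D: "D n \<in> hyperspace" for n
    by (induction n) (auto simp: D_def C(1) hutchinson_in_hyperspace[OF F])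
  have DSuc: "D (Suc n) = hutchinson m f (D n)" for n
    by (simp add: D_def)
  have "D (Suc n) \<subseteq> D n" for n
  proof (induction n)
    case 0
    then show ?case using C(2) by (simp add: D_def)
  next
    case (Suc n)
    then show ?case by (metis DSuc hutchinson_mono)
  qed
  then have dec: "decseq D" by (rule decseq_SucI)
  let ?A = "\<Inter>n. D n"
  have cl: "closed (D n)" "compact (D n)" "D n \<noteq> {}" for n
    using D[of n] by (auto simp: hyperspace_def compact_imp_closed)
  have "closed ?A"
    using cl by blast
  then have "compact (D 0 \<inter> ?A)"
    using cl by (intro compact_Int_closed)
  moreover have "D 0 \<inter> ?A = ?A" by blast
  ultimately have "?A \<in> hyperspace"
    using compact_decseq_Inter_nonempty[OF cl(2,3) dec] by (simp add: hyperspace_def)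
  moreover have "?A \<subseteq> C"
    using INT_lower[of 0 UNIV D] by (simp add: D_def)
  moreover have "hutchinson m f ?A \<subseteq> ?A"
  proof (rule INT_greatest)
    fix n
    have "hutchinson m f ?A \<subseteq> D (Suc n)"
      unfolding DSuc by (intro hutchinson_mono) blast
    then show "hutchinson m f ?A \<subseteq> D n"
      using decseqD[OF dec, of n "Suc n"] by auto
  qed
  moreover have "?A \<subseteq> hutchinson m f ?A"
  proof
    fix y assume y: "y \<in> ?A"
    \<comment> \<open>All points sent to \<open>y\<close> by some map. Since \<open>y\<close> lies
      in each \<open>D (Suc n)\<close>, this closed set meets each \<open>D n\<close>, and by
      compactness it meets their intersection.\<close>
    let ?P = "\<Union>i\<in>{1..m}. f i -` {y}"
    have "closed ?P"
      using F by (intro closed_UN) (auto simp: ifs_def intro!: closed_vimage)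
    then have "compact (D n \<inter> ?P)" for n
      using cl by (intro compact_Int_closed)
    moreover have "D n \<inter> ?P \<noteq> {}" for n
    proof -
      have "y \<in> D (Suc n)" using y by blast
      then show ?thesis by (auto simp: DSuc hutchinson_def)
    qed
    moreover have "decseq (\<lambda>n. D n \<inter> ?P)"
      using dec unfolding decseq_def by blast
    ultimately have "(\<Inter>n. D n \<inter> ?P) \<noteq> {}"
      by (rule compact_decseq_Inter_nonempty)
    then show "y \<in> hutchinson m f ?A"
      by (auto simp: hutchinson_def)
  qed
  ultimately show thesis
    by (intro that) auto
qed

lemma hutchinson_closure_orbit:
  assumes F: "ifs m f"
  shows "hutchinson m f (closure (ifs_orbit m f x)) \<subseteq> closure (ifs_orbit m f x)"
proof -
  have "f i ` closure (ifs_orbit m f x) \<subseteq> closure (ifs_orbit m f x)" if i: "i \<in> {1..m}" for i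
  proof (rule image_closure_subset)
    show "continuous_on (closure (ifs_orbit m f x)) (f i)"
      by (rule ifs_continuous_on[OF F i])
    show "f i ` ifs_orbit m f x \<subseteq> closure (ifs_orbit m f x)"
      using ifs_orbit_step[OF _ i] closure_subset by fast
  qed auto
  then show ?thesis unfolding hutchinson_def by (rule UN_least)
qed

lemma fixed_point_in_orbit_closure:
  fixes f :: "nat \<Rightarrow> 'a::metric_space \<Rightarrow> 'a"
  assumes F: "ifs m f" and G: "compact G" "hutchinson m f G \<subseteq> G" and x: "x \<in> G"
  obtains A where "A \<in> hyperspace" "hutchinson m f A = A" "A \<subseteq> closure (ifs_orbit m f x)"
proof -
  let ?C = "closure (ifs_orbit m f x)"
  have "?C \<subseteq> G"
    using ifs_orbit_subset[OF G(2) x] G(1) by (simp add: closure_minimal compact_imp_closed)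
  then have "compact ?C"
    using G(1) by (metis closed_closure compact_Int_closed inf.absorb2)
  moreover have "?C \<noteq> {}"
    using ifs_orbit_refl[of x m f] by auto
  ultimately have "?C \<in> hyperspace"
    by (simp add: hyperspace_def)
  then show thesis
    using hutchinson_fixed_point_below[OF F _ hutchinson_closure_orbit[OF F]] that by metis
qed

text \<open>Errors occur only after a map is applied, so \<open>a\<close> is written as
  \<open>f i c\<close> with \<open>c\<close> in \<open>A\<close>. An orbit point \<open>y\<close>
  near \<open>c\<close> is reached exactly, and the step from \<open>y\<close> to \<open>a\<close>
  has small error by continuity.\<close>

lemma chain_geq_to_fixed_point:
  fixes f :: "nat \<Rightarrow> 'a::metric_space \<Rightarrow> 'a"
  assumes F: "ifs m f" and A: "hutchinson m f A = A" "A \<subseteq> closure (ifs_orbit m f x)"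
    and a: "a \<in> A"
  shows "chain_geq UNIV dist m f x a"
  unfolding chain_geq_iff
proof (intro conjI allI impI)
  fix \<epsilon> :: real assume "\<epsilon> > 0"
  from a A(1) have "a \<in> (\<Union>i\<in>{1..m}. f i ` A)"
    by (simp add: hutchinson_def)
  then obtain i c where i: "i \<in> {1..m}" "c \<in> A" "a = f i c"
    by blast
  then have "continuous (at c) (f i)"
    using F by (auto simp: ifs_def continuous_on_eq_continuous_at)
  then obtain \<delta> where \<delta>: "\<delta> > 0" "\<And>z. dist z c < \<delta> \<Longrightarrow> dist (f i z) (f i c) < \<epsilon>"
    using \<open>\<epsilon> > 0\<close> unfolding continuous_at_eps_delta by blast
  obtain y where y: "y \<in> ifs_orbit m f x" "dist y c < \<delta>"
    using i(2) A(2) \<delta>(1) by (meson closure_approachable subsetD)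
  have "(x, y) \<in> (chain_step UNIV dist m f \<epsilon>)\<^sup>*"
    using chain_geq_ifs_orbit[OF y(1)] \<open>\<epsilon> > 0\<close> by (simp add: chain_geq_iff)
  moreover have "(y, a) \<in> chain_step UNIV dist m f \<epsilon>"
    using \<delta>(2)[OF y(2)] i by (auto simp: chain_step_def)
  ultimately show "(x, a) \<in> (chain_step UNIV dist m f \<epsilon>)\<^sup>*"
    by (rule rtrancl_into_rtrancl)
qed simp

text \<open>For an orbit point \<open>y\<close> near \<open>a\<close>, the first step goes from
  \<open>a\<close> to \<open>f 1 y\<close>; this is again an orbit point of \<open>x\<close>, so
  recurrence leads back to \<open>x\<close>.\<close>

lemma chain_geq_from_orbit_closure:
  fixes f :: "nat \<Rightarrow> 'a::metric_space \<Rightarrow> 'a"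
  assumes F: "ifs m f" and x: "x \<in> orbitwise_chain_recurrent UNIV dist m f"
    and a: "a \<in> closure (ifs_orbit m f x)"
  shows "chain_geq UNIV dist m f a x"
  unfolding chain_geq_iff
proof (intro conjI allI impI)
  fix \<epsilon> :: real assume "\<epsilon> > 0"
  have i: "1 \<in> {1..m}" and "continuous (at a) (f 1)"
    using F by (auto simp: ifs_def continuous_on_eq_continuous_at)
  then obtain \<delta> where \<delta>: "\<delta> > 0" "\<And>z. dist z a < \<delta> \<Longrightarrow> dist (f 1 z) (f 1 a) < \<epsilon>"
    using \<open>\<epsilon> > 0\<close> unfolding continuous_at_eps_delta by blast
  obtain y where y: "y \<in> ifs_orbit m f x" "dist y a < \<delta>"
    using a \<delta>(1) by (meson closure_approachable)
  have "dist (f 1 a) (f 1 y) < \<epsilon>"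
    using \<delta>(2)[OF y(2)] by (simp add: dist_commute)
  then have "(a, f 1 y) \<in> chain_step UNIV dist m f \<epsilon>"
    using i by (auto simp: chain_step_def)
  moreover have "(f 1 y, x) \<in> (chain_step UNIV dist m f \<epsilon>)\<^sup>*"
    using ifs_orbit_step[OF y(1) i] x \<open>\<epsilon> > 0\<close>
    by (auto simp: orbitwise_chain_recurrent_def chain_equiv_def chain_geq_iff)
  ultimately show "(a, x) \<in> (chain_step UNIV dist m f \<epsilon>)\<^sup>*"
    by (rule converse_rtrancl_into_rtrancl)
qed simp

section \<open>Chains of the Hutchinson map\<close>

text \<open>Compactness of \<open>B\<close> bounds the distances, so that the real supremum is an
  upper bound.\<close>

lemma infdist_le_hausdorff_dist:
  assumes "compact B" and "b \<in> B"
  shows "infdist b A \<le> hausdorff_dist A B"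
proof -
  have "compact ((\<lambda>b. infdist b A) ` B)"
    using assms(1) by (intro compact_continuous_image continuous_intros)
  then have "bdd_above ((\<lambda>b. infdist b A) ` B)"
    by (intro bounded_imp_bdd_above compact_imp_bounded)
  then have "infdist b A \<le> (SUP b\<in>B. infdist b A)"
    using assms(2) by (intro cSUP_upper)
  then show ?thesis by (simp add: hausdorff_dist_def)
qed

text \<open>Each point of a set in the chain is within \<open>\<epsilon>\<close> of the image of the
  preceding set, hence has a predecessor there. The endpoint \<open>b\<close> is kept general
  because it changes at each step; \<open>\<epsilon>\<close> does not grow.\<close>

lemma hutchinson_chain_lift:
  fixes f :: "nat \<Rightarrow> 'a::metric_space \<Rightarrow> 'a"
  assumes F: "ifs m f" and A: "A \<in> hyperspace"
    and chain: "(A, B) \<in> (chain_step hyperspace hausdorff_dist 1 (\<lambda>_. hutchinson m f) \<epsilon>)\<^sup>*"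
    and "b \<in> B"
  shows "\<exists>a\<in>A. (a, b) \<in> (chain_step UNIV dist m f \<epsilon>)\<^sup>*"
  using chain \<open>b \<in> B\<close>
proof (induction arbitrary: b rule: rtrancl_induct)
  case base
  then show ?case by blast
next
  case (step K L)
  have KL: "K \<in> hyperspace" "L \<in> hyperspace" "hausdorff_dist (hutchinson m f K) L < \<epsilon>"
    using step.hyps(2) by (auto simp: chain_step_def)
  then have "infdist b (hutchinson m f K) < \<epsilon>"
    using infdist_le_hausdorff_dist[of L b "hutchinson m f K"] step.prems
    by (simp add: hyperspace_def)
  \<comment> \<open>Excludes the default value 0 of \<open>infdist\<close> at the empty set.\<close>
  moreover have "hutchinson m f K \<noteq> {}"
    using hutchinson_in_hyperspace[OF F KL(1)] by (simp add: hyperspace_def)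
  ultimately obtain c where c: "c \<in> hutchinson m f K" "dist b c < \<epsilon>"
    using infdist_less_obtains by blast
  then obtain i k where k: "i \<in> {1..m}" "k \<in> K" "c = f i k"
    by (auto simp: hutchinson_def)
  then have "(k, b) \<in> chain_step UNIV dist m f \<epsilon>"
    using c(2) by (auto simp: chain_step_def dist_commute)
  then show ?case
    using step.IH[OF k(2)] by (meson rtrancl_into_rtrancl)
qed

text \<open>The starting point found in \<open>A\<close> depends on \<open>\<epsilon>\<close>, so
  \<open>x\<close> is asked to reach every point of \<open>A\<close>.\<close>

lemma chain_geq_of_hutchinson:
  fixes f :: "nat \<Rightarrow> 'a::metric_space \<Rightarrow> 'a"
  assumes F: "ifs m f"
    and AB: "chain_geq hyperspace hausdorff_dist 1 (\<lambda>_. hutchinson m f) A B"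
    and x: "\<And>a. a \<in> A \<Longrightarrow> chain_geq UNIV dist m f x a" and b: "b \<in> B"
  shows "chain_geq UNIV dist m f x b"
  unfolding chain_geq_iff
proof (intro conjI allI impI)
  fix \<epsilon> :: real assume "\<epsilon> > 0"
  then obtain a where "a \<in> A" "(a, b) \<in> (chain_step UNIV dist m f \<epsilon>)\<^sup>*"
    using hutchinson_chain_lift[OF F _ _ b] AB unfolding chain_geq_iff by blast
  then show "(x, b) \<in> (chain_step UNIV dist m f \<epsilon>)\<^sup>*"
    using x \<open>\<epsilon> > 0\<close> unfolding chain_geq_iff by (meson rtrancl_trans)
qed simp

abbreviation hutchinson_recurrent ::
    "nat \<Rightarrow> (nat \<Rightarrow> 'a::metric_space \<Rightarrow> 'a) \<Rightarrow> 'a set set"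
  where "hutchinson_recurrent m f \<equiv>
    chain_recurrent hyperspace hausdorff_dist 1 (\<lambda>_. hutchinson m f)"

abbreviation hutchinson_equiv ::
    "nat \<Rightarrow> (nat \<Rightarrow> 'a::metric_space \<Rightarrow> 'a) \<Rightarrow> 'a set \<Rightarrow> 'a set \<Rightarrow> bool"
  where "hutchinson_equiv m f \<equiv>
    chain_equiv hyperspace hausdorff_dist 1 (\<lambda>_. hutchinson m f)"

lemma fixed_point_hutchinson_recurrent:
  "A \<in> hyperspace \<Longrightarrow> hutchinson m f A = A \<Longrightarrow> A \<in> hutchinson_recurrent m f"
  by (simp add: chain_recurrent_def chain_equiv_refl)

section \<open>Comparison of the sets of nodes\<close>

lemma pverts_graph_of_nodes [simp]: "pverts (graph_of_nodes Y d m f V) = V"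
  by (simp add: graph_of_nodes_def)

text \<open>The map \<open>h\<close> reflects equivalence but may separate equivalent points, so
  each class is sent on through one chosen representative \<open>p N\<close>.\<close>

lemma quotient_lepoll:
  assumes "equiv R r" and "equiv S s" and h: "\<And>x. x \<in> R \<Longrightarrow> h x \<in> S"
    and hr: "\<And>x y. x \<in> R \<Longrightarrow> y \<in> R \<Longrightarrow> (h x, h y) \<in> s \<Longrightarrow> (x, y) \<in> r"
  shows "R // r \<lesssim> S // s"
proof -
  define p where "p N = (SOME x. x \<in> R \<and> N = r `` {x})" for N
  have p: "p N \<in> R \<and> N = r `` {p N}" if "N \<in> R // r" for N
    unfolding p_def by (rule someI_ex) (use that in \<open>unfold quotient_def, blast\<close>)
  have "inj_on (\<lambda>N. s `` {h (p N)}) (R // r)"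
  proof (rule inj_onI)
    fix M N assume MN: "M \<in> R // r" "N \<in> R // r" and eq: "s `` {h (p M)} = s `` {h (p N)}"
    have "(h (p M), h (p N)) \<in> s"
      using eq_equiv_class[OF eq assms(2)] h p[OF MN(2)] by blast
    then have "(p M, p N) \<in> r"
      using hr p MN by blast
    then show "M = N"
      using equiv_class_eq[OF assms(1)] p MN by metis
  qed
  moreover have "(\<lambda>N. s `` {h (p N)}) ` (R // r) \<subseteq> S // s"
    using h p by (auto intro: quotientI)
  ultimately show ?thesis
    unfolding lepoll_def by blast
qed

lemma orbitwise_nodes_lepoll_hutchinson_nodes:
  fixes f :: "nat \<Rightarrow> 'a::metric_space \<Rightarrow> 'a"
  assumes F: "ifs m f" and G: "compact G" "hutchinson m f G \<subseteq> G"
    and sub: "orbitwise_chain_recurrent UNIV dist m f \<subseteq> G"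
  shows "pverts (orbitwise_chain_graph UNIV dist m f) \<lesssim> pverts (hutchinson_chain_graph m f)"
proof -
  let ?R = "orbitwise_chain_recurrent UNIV dist m f"
  let ?S = "hutchinson_recurrent m f"
  have "\<exists>A. A \<in> ?S \<and> A \<noteq> {} \<and> (\<forall>a\<in>A. chain_equiv UNIV dist m f x a)" if x: "x \<in> ?R" for x
  proof -
    have "x \<in> G" using x sub by (rule rev_subsetD)
    then obtain A where A: "A \<in> hyperspace" "hutchinson m f A = A" "A \<subseteq> closure (ifs_orbit m f x)"
      by (rule fixed_point_in_orbit_closure[OF F G])
    have "chain_equiv UNIV dist m f x a" if "a \<in> A" for a
      unfolding chain_equiv_def
      using chain_geq_to_fixed_point[OF F A(2,3) that]
        chain_geq_from_orbit_closure[OF F x subsetD[OF A(3) that]] by (rule conjI)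
    moreover have "A \<in> ?S"
      by (rule fixed_point_hutchinson_recurrent[OF A(1,2)])
    moreover have "A \<noteq> {}"
      using A(1) by (simp add: hyperspace_def)
    ultimately show ?thesis by blast
  qed
  then obtain A where A: "\<And>x. x \<in> ?R \<Longrightarrow> A x \<in> ?S" "\<And>x. x \<in> ?R \<Longrightarrow> A x \<noteq> {}"
      "\<And>x a. x \<in> ?R \<Longrightarrow> a \<in> A x \<Longrightarrow> chain_equiv UNIV dist m f x a"
    by metis
  \<comment> \<open>The route goes from \<open>x\<close> to the points of \<open>A x\<close>, along
    lifted chains to a point \<open>b\<close> of \<open>A y\<close>, and on to \<open>y\<close>.
    Exchanging \<open>x\<close> and \<open>y\<close> gives the converse.\<close>
  have geq: "chain_geq UNIV dist m f x y"
    if xy: "x \<in> ?R" "y \<in> ?R" and eq: "hutchinson_equiv m f (A x) (A y)" for x y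
  proof -
    obtain b where b: "b \<in> A y" using A(2)[OF xy(2)] by blast
    have "chain_geq UNIV dist m f x b"
    proof (rule chain_geq_of_hutchinson[OF F _ _ b])
      show "chain_geq hyperspace hausdorff_dist 1 (\<lambda>_. hutchinson m f) (A x) (A y)"
        using eq by (simp only: chain_equiv_def)
      show "chain_geq UNIV dist m f x a" if "a \<in> A x" for a
        using A(3)[OF xy(1) that] by (simp only: chain_equiv_def)
    qed
    moreover have "chain_geq UNIV dist m f b y"
      using A(3)[OF xy(2) b] by (simp add: chain_equiv_def)
    ultimately show ?thesis by (rule chain_geq_trans)
  qed
  have "chain_equiv UNIV dist m f x y"
    if "x \<in> ?R" "y \<in> ?R" "hutchinson_equiv m f (A x) (A y)" for x y
    using geq[OF that] geq[OF that(2,1) chain_equiv_sym[OF that(3)]]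
    by (simp add: chain_equiv_def)
  then have "chain_classes UNIV dist m f ?R \<lesssim>
      chain_classes hyperspace hausdorff_dist 1 (\<lambda>_. hutchinson m f) ?S"
    unfolding chain_classes_def using A(1)
    by (intro quotient_lepoll[where h = A] equiv_chain_equiv chain_recurrent_subset) simp_all
  then show ?thesis
    by (simp add: orbitwise_chain_graph_def hutchinson_chain_graph_def chain_graph_def)
qed

text \<open>Recurrence of \<open>x\<close> is not yet known, but \<open>x\<close> reaches all of the
  fixed point \<open>A\<close> taken from its orbit closure. Both \<open>A\<close> and
  \<open>G\<close> are recurrent, so they share the single node and chains lead on from
  \<open>A\<close> to \<open>y\<close>.\<close>

lemma attractor_chain_geq_of_unique_hutchinson_node:
  fixes f :: "nat \<Rightarrow> 'a::metric_space \<Rightarrow> 'a"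
  assumes F: "ifs m f" and G: "G \<in> hyperspace" "hutchinson m f G = G"
    and uniq: "\<exists>!N. N \<in> pverts (hutchinson_chain_graph m f)" and xy: "x \<in> G" "y \<in> G"
  shows "chain_geq UNIV dist m f x y"
proof -
  let ?S = "hutchinson_recurrent m f"
  let ?s = "{(A, B). A \<in> ?S \<and> B \<in> ?S \<and> hutchinson_equiv m f A B}"
  have eqs: "equiv ?S ?s"
    by (simp add: equiv_chain_equiv chain_recurrent_subset)
  have cG: "compact G" using G(1) by (simp add: hyperspace_def)
  obtain A where A: "A \<in> hyperspace" "hutchinson m f A = A" "A \<subseteq> closure (ifs_orbit m f x)"
    using fixed_point_in_orbit_closure[OF F cG _ xy(1)] G(2) by blast
  have AG: "A \<in> ?S" "G \<in> ?S"
    using fixed_point_hutchinson_recurrent A G by blast+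
  define Q where "Q = ?S // ?s"
  have "\<exists>!N. N \<in> Q"
    using uniq unfolding Q_def hutchinson_chain_graph_def chain_graph_def chain_classes_def
      pverts_graph_of_nodes .
  then have eq: "M = N" if "M \<in> Q" "N \<in> Q" for M N
    using that by blast
  have "?s `` {A} = ?s `` {G}"
    by (rule eq) (simp_all only: Q_def quotientI AG)
  then have "(A, G) \<in> ?s"
    using eqs AG(2) by (rule eq_equiv_class)
  then have "hutchinson_equiv m f A G"
    by simp
  then have "chain_geq hyperspace hausdorff_dist 1 (\<lambda>_. hutchinson m f) A G"
    by (simp only: chain_equiv_def)
  then show ?thesis
    using chain_geq_to_fixed_point[OF F A(2,3)] xy(2) by (rule chain_geq_of_hutchinson[OF F])
qed

lemma chain_classes_singleton:
  assumes "R \<noteq> {}" and "\<And>x y. x \<in> R \<Longrightarrow> y \<in> R \<Longrightarrow> chain_equiv Y d m f x y"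
  shows "chain_classes Y d m f R = {R}"
proof -
  have "{(x, y). x \<in> R \<and> y \<in> R \<and> chain_equiv Y d m f x y} `` {x} = R" if "x \<in> R" for x
    using that assms(2) by blast
  then show ?thesis
    using assms(1) unfolding chain_classes_def quotient_def by auto
qed

theorem theorem10:
  fixes f :: "nat \<Rightarrow> 'a::metric_space \<Rightarrow> 'a" and m :: nat and G :: "'a set"
  assumes "separable_space (euclidean :: 'a topology)"
    and "locally_compact_space (euclidean :: 'a topology)"
    and "ifs m f"
    and "global_attractor m f G"
  shows "pverts (orbitwise_chain_graph UNIV dist m f) \<lesssim> pverts (hutchinson_chain_graph m f) \<and>
    ((\<exists>!N. N \<in> pverts (hutchinson_chain_graph m f)) \<longrightarrow>
       pverts (chain_graph UNIV dist m f) = {G} \<and>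
       pverts (orbitwise_chain_graph UNIV dist m f) = {G})"
proof (intro conjI impI)
  have m: "m \<ge> 1" using assms(3) by (simp add: ifs_def)
  have G: "compact G" "hutchinson m f G = G" "G \<noteq> {}"
    using assms(4) global_attractor_nonempty[OF assms(4) m] by (auto simp: global_attractor_def)
  have ocr: "orbitwise_chain_recurrent UNIV dist m f \<subseteq> chain_recurrent UNIV dist m f"
    by (rule orbitwise_chain_recurrent_subset_chain_recurrent[OF m])
  have cr: "chain_recurrent UNIV dist m f \<subseteq> G"
    by (rule chain_recurrent_subset_attractor[OF assms(2-4)])
  show "pverts (orbitwise_chain_graph UNIV dist m f) \<lesssim> pverts (hutchinson_chain_graph m f)"
    using orbitwise_nodes_lepoll_hutchinson_nodes[OF assms(3) G(1)] G(2) ocr cr by blast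
  assume uniq: "\<exists>!N. N \<in> pverts (hutchinson_chain_graph m f)"
  have "G \<in> hyperspace" using G by (simp add: hyperspace_def)
  then have equiv: "chain_equiv UNIV dist m f x y" if "x \<in> G" "y \<in> G" for x y
    using attractor_chain_geq_of_unique_hutchinson_node[OF assms(3) _ G(2) uniq] that
    by (simp add: chain_equiv_def)
  \<comment> \<open>Invariance keeps orbits in \<open>G\<close>, where all points are equivalent.
    With \<open>ocr\<close> and \<open>cr\<close> both recurrent sets then equal \<open>G\<close>,
    and each is a single class.\<close>
  have "G \<subseteq> orbitwise_chain_recurrent UNIV dist m f"
    using ifs_orbit_subset[of m f G] G(2) equiv by (fastforce simp: orbitwise_chain_recurrent_def)
  with ocr cr have "orbitwise_chain_recurrent UNIV dist m f = G" "chain_recurrent UNIV dist m f = G"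
    by blast+
  then show "pverts (chain_graph UNIV dist m f) = {G}"
      "pverts (orbitwise_chain_graph UNIV dist m f) = {G}"
    using chain_classes_singleton[OF G(3)] equiv
    by (auto simp: chain_graph_def orbitwise_chain_graph_def)
qed

end
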